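(* Let $F$ be a field, $n\ge 1$, and $c$ a reduced skew set of degree $n$ over $F$. If $c_{iji}\neq 0$ for every $i,j$, then the skew matrix algebra $M_n(F;c)$ is simple.
   Context: A skew set of degree $n$ over $F$ is a family $c=(c_{ijk})_{1\le i,j,k\le n}$ of scalars in $F$ (zeros allowed); it is reduced if $c_{iij}=c_{ijj}=1$ for all $i,j$. For a reduced skew set $c$, the skew matrix algebra $M_n(F;c)$ is the (in general nonassociative) $F$-algebra with basis $\{e_{ij}\}_{1\le i,j\le n}$ and multiplication $e_{ij}e_{k\ell}=\delta_{jk}c_{ij\ell}e_{i\ell}$. *)

theory Defs
  imports "HOL-Analysis.Finite_Cartesian_Product"
begin

locale nonassoc_algebra = vector_space scale
  for scale :: "'a::field \<Rightarrow> 'b::ab_group_add \<Rightarrow> 'b" +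
  fixes mult :: "'b \<Rightarrow> 'b \<Rightarrow> 'b"
  assumes mult_add_left: "mult (x + y) z = mult x z + mult y z"
    and mult_add_right: "mult x (y + z) = mult x y + mult x z"
    and mult_scale_left: "mult (scale a x) y = scale a (mult x y)"
    and mult_scale_right: "mult x (scale a y) = scale a (mult x y)"
begin

definition two_sided_ideal :: "'b set \<Rightarrow> bool" where
  "two_sided_ideal I \<longleftrightarrow> subspace I \<and> (\<forall>x\<in>I. \<forall>y. mult x y \<in> I \<and> mult y x \<in> I)"

end

text \<open>
  For algebras without an assumed unit, simplicity includes the requirement that the
  product is not identically zero; in particular the zero algebra is not simple.
\<close>

locale simple_nonassoc_algebra = nonassoc_algebra +
  assumes mult_nonzero: "\<exists>x y. mult x y \<noteq> 0"
    and ideals_trivial: "two_sided_ideal I \<Longrightarrow> I = {0} \<or> I = UNIV"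

text \<open>
  The index set \<open>{1..n}\<close> is a finite type \<open>'n\<close>, with \<open>n = CARD('n) \<ge> 1\<close>.
\<close>

type_synonym ('a, 'n) skew_set = "'n \<Rightarrow> 'n \<Rightarrow> 'n \<Rightarrow> 'a"

definition reduced :: "('a::field, 'n::finite) skew_set \<Rightarrow> bool" where
  "reduced c \<longleftrightarrow> (\<forall>i j. c i i j = 1 \<and> c i j j = 1)"

definition mat_scale :: "'a::field \<Rightarrow> 'a^'n^'n \<Rightarrow> 'a^'n^'n" where
  "mat_scale a A = (\<chi> i j. a * A $ i $ j)"

definition mat_unit :: "'n \<Rightarrow> 'n \<Rightarrow> 'a::field^'n^'n" where
  "mat_unit i j = axis i (axis j 1)"

text \<open>
  The bilinear extension of the product of basis elements
  \<open>e i j \<cdot> e k l = (if j = k then c i j l \<cdot> e i l else 0)\<close>.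
\<close>

definition skew_mult ::
  "('a::field, 'n::finite) skew_set \<Rightarrow> 'a^'n^'n \<Rightarrow> 'a^'n^'n \<Rightarrow> 'a^'n^'n" where
  "skew_mult c A B =
    (\<Sum>i\<in>UNIV. \<Sum>j\<in>UNIV. \<Sum>k\<in>UNIV. \<Sum>l\<in>UNIV.
      mat_scale (A $ i $ j * B $ k $ l)
        (if j = k then mat_scale (c i j l) (mat_unit i l) else 0))"

lemma mat_scale_nth [simp]: "mat_scale a A $ i $ j = a * A $ i $ j"
  by (simp add: mat_scale_def)

lemma mat_unit_nth: "mat_unit i j $ k $ l = (if i = k \<and> j = l then 1 else 0)"
  by (auto simp: mat_unit_def axis_def)

lemma vector_space_mat_scale:
  "vector_space (mat_scale :: 'a::field \<Rightarrow> 'a^'n::finite^'n \<Rightarrow> 'a^'n^'n)"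
  by unfold_locales (auto simp: vec_eq_iff algebra_simps)

lemma skew_mult_nth:
  "skew_mult c A B $ i $ l = (\<Sum>j\<in>UNIV. c i j l * A $ i $ j * B $ j $ l)"
proof -
  have *: "(mat_scale (A $ i' $ j * B $ k $ l')
        (if j = k then mat_scale (c i' j l') (mat_unit i' l') else 0)) $ i $ l
     = (if l' = l then if k = j then if i' = i
          then c i j l * A $ i $ j * B $ j $ l else 0 else 0 else 0)" for i' j k l'
    by (auto simp: mat_unit_nth)
  have "skew_mult c A B $ i $ l =
      (\<Sum>i'\<in>UNIV. \<Sum>j\<in>UNIV. if i' = i then c i j l * A $ i $ j * B $ j $ l else 0)"
    unfolding skew_mult_def sum_component * by simp
  also have "\<dots> = (\<Sum>j\<in>UNIV. \<Sum>i'\<in>UNIV. if i' = i then c i j l * A $ i $ j * B $ j $ l else 0)"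
    by (rule sum.swap)
  finally show ?thesis by simp
qed

lemma skew_mult_mat_unit:
  "skew_mult c (mat_unit i j) (mat_unit k l) =
    (if j = k then mat_scale (c i j l) (mat_unit i l) else 0)"
proof -
  have "skew_mult c (mat_unit i j) (mat_unit k l) $ p $ q =
      (\<Sum>r\<in>UNIV. if r = j then (if j = k \<and> i = p \<and> l = q then c i j l else 0) else 0)" for p q
    unfolding skew_mult_nth by (rule sum.cong) (auto simp: mat_unit_nth)
  then show ?thesis
    by (auto simp: vec_eq_iff mat_unit_nth)
qed

lemma sum_mat_unit_nth:
  "(\<Sum>i\<in>UNIV. \<Sum>j\<in>UNIV. mat_scale (a i j) (mat_unit i j :: 'a::field^'n::finite^'n)) $ k $ l = a k l"
proof -
  have *: "mat_scale (a i j) (mat_unit i j) $ k $ l =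
      (if j = l then if i = k then a k l else 0 else 0)" for i j
    by (auto simp: mat_unit_nth)
  show ?thesis unfolding sum_component * by simp
qed

lemma nonassoc_algebra_skew_mult:
  "nonassoc_algebra mat_scale (skew_mult c :: 'a::field^'n::finite^'n \<Rightarrow> _)"
proof -
  interpret vector_space "mat_scale :: 'a \<Rightarrow> 'a^'n^'n \<Rightarrow> 'a^'n^'n"
    by (rule vector_space_mat_scale)
  show ?thesis
    by unfold_locales
      (auto simp: vec_eq_iff skew_mult_nth algebra_simps sum.distrib sum_distrib_left)
qed

end

theory Submission
  imports Defs
begin

text \<open>
  Compressing a nonzero element of an ideal \<open>I\<close> between diagonal units leaves a nonzero multiple
  of some \<open>e p q\<close>, and \<open>e p q \<cdot> e q p = c p q p \<cdot> e p p\<close> then puts \<open>e p p\<close> into \<open>I\<close>. One cannot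
  pass from there to \<open>e i j\<close> through \<open>e i p \<cdot> e p j\<close>, since \<open>c i p j\<close> may vanish; instead
  \<open>e i p = e i p \<cdot> e p p\<close> lies in \<open>I\<close>, hence so does \<open>e i p \<cdot> e p i = c i p i \<cdot> e i i\<close>, and
  \<open>e i j = e i i \<cdot> e i j\<close>.
\<close>

lemma mat_unit_nonzero: "mat_unit i j \<noteq> (0 :: 'a::field^'n::finite^'n)"
proof
  assume "mat_unit i j = (0 :: 'a^'n^'n)"
  then have "mat_unit i j $ i $ j = (0 :: 'a)"
    by simp
  then show False
    by (simp add: mat_unit_nth)
qed

text \<open>Only the constants \<open>c i q q\<close> and \<open>c p p l\<close> occur, and
  reducedness makes them 1; so diagonal units cut out rows and columns as in the ordinary matrix
  algebra.\<close>

lemma skew_mult_compress: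
  fixes c :: "('a::field, 'n::finite) skew_set"
  assumes "reduced c"
  shows "skew_mult c (mat_unit p p) (skew_mult c A (mat_unit q q)) =
    mat_scale (A $ p $ q) (mat_unit p q)"
proof -
  have right: "skew_mult c A (mat_unit q q) $ i $ l = (if l = q then A $ i $ q else 0)" for i l
  proof -
    have "skew_mult c A (mat_unit q q) $ i $ l =
        (\<Sum>j\<in>UNIV. if j = q then (if l = q then A $ i $ q else 0) else 0)"
      unfolding skew_mult_nth
      using assms by (intro sum.cong) (auto simp: mat_unit_nth reduced_def)
    then show ?thesis
      by simp
  qed
  have left: "skew_mult c (mat_unit p p) B $ i $ l = (if i = p then B $ p $ l else 0)" for B i l
  proof -
    have "skew_mult c (mat_unit p p) B $ i $ l =
        (\<Sum>j\<in>UNIV. if j = p then (if i = p then B $ p $ l else 0) else 0)"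
      unfolding skew_mult_nth
      using assms by (intro sum.cong) (auto simp: mat_unit_nth reduced_def)
    then show ?thesis
      by simp
  qed
  show ?thesis
    by (auto simp: vec_eq_iff left right mat_unit_nth)
qed

lemma mat_eq_sum_mat_unit:
  fixes A :: "'a::field^'n::finite^'n"
  shows "A = (\<Sum>i\<in>UNIV. \<Sum>j\<in>UNIV. mat_scale (A $ i $ j) (mat_unit i j))"
  unfolding vec_eq_iff sum_mat_unit_nth by simp

theorem corollary9p12:
  fixes c :: "('a::field, 'n::finite) skew_set"
  assumes "reduced c"
    and "\<forall>i j. c i j i \<noteq> 0"
  shows "simple_nonassoc_algebra mat_scale (skew_mult c)"
proof -
  interpret nonassoc_algebra mat_scale "skew_mult c"
    by (rule nonassoc_algebra_skew_mult)
  show ?thesis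
  proof unfold_locales
    have "skew_mult c (mat_unit i i) (mat_unit i i) \<noteq> 0" for i
      using assms(2) by (simp add: skew_mult_mat_unit mat_unit_nonzero)
    then show "\<exists>x y. skew_mult c x y \<noteq> 0"
      by blast
  next
    fix I :: "('a^'n^'n) set"
    assume "two_sided_ideal I"
    then have sub: "subspace I"
      and multR: "\<And>x y. x \<in> I \<Longrightarrow> skew_mult c x y \<in> I"
      and multL: "\<And>x y. x \<in> I \<Longrightarrow> skew_mult c y x \<in> I"
      by (auto simp: two_sided_ideal_def)
    have unscale: "x \<in> I" if "mat_scale a x \<in> I" "a \<noteq> 0" for a x
      using subspace_scale[OF sub that(1), of "inverse a"] that(2) by simp
    show "I = {0} \<or> I = UNIV"
    proof (cases "I \<subseteq> {0}")
      case True
      then show ?thesis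
        using subspace_0[OF sub] by blast
    next
      case False
      then obtain A where "A \<in> I" "A \<noteq> 0"
        by blast
      then obtain p q where A: "A \<in> I" "A $ p $ q \<noteq> 0"
        by (auto simp: vec_eq_iff)
      have "mat_scale (A $ p $ q) (mat_unit p q) \<in> I"
        using multL[OF multR[OF A(1)]] skew_mult_compress[OF assms(1)] by metis
      then have pq: "mat_unit p q \<in> I"
        using A(2) unscale by blast
      \<comment> \<open>Applied twice below: at \<open>(p, q)\<close> it yields
        \<open>mat_unit p p\<close>, and at \<open>(i, p)\<close> it yields every
        \<open>mat_unit i i\<close>.\<close>
      have diag: "mat_unit i i \<in> I" if "mat_unit i j \<in> I" for i j
      proof (rule unscale)
        show "mat_scale (c i j i) (mat_unit i i) \<in> I"
          using multR[OF that, of "mat_unit j i"] by (simp add: skew_mult_mat_unit)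
      qed (use assms(2) in simp)
      \<comment> \<open>The constant of this product is \<open>c i p p = 1\<close>.\<close>
      have "mat_unit i p \<in> I" for i
        using multL[OF diag[OF pq], of "mat_unit i p"] assms(1)
        by (simp add: skew_mult_mat_unit reduced_def)
      \<comment> \<open>Multiplying from the diagonal unit \<open>mat_unit i i\<close> involves only
        \<open>c i i j = 1\<close>, so no possibly vanishing constant enters.\<close>
      then have "mat_unit i j \<in> I" for i j
        using multR[OF diag, of i p "mat_unit i j"] assms(1)
        by (simp add: skew_mult_mat_unit reduced_def)
      then have "B \<in> I" for B
        by (subst mat_eq_sum_mat_unit) (intro subspace_sum subspace_scale sub)
      then show ?thesis
        by blast
    qed
  qed
qed

end
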